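(* Let $V$ be a nonzero finite-dimensional complex vector space, let $B\subset V^*$ be a finite spanning multiset of nonzero vectors, let $\mathcal{H}$ be the central hyperplane arrangement in $V$ defined by $B$, and let $\mathcal{H}^c\subset(\mathbb{C}^\times)^B$ be the image of $V\smallsetminus\mathcal{H}$ under $v\mapsto(\langle b,v\rangle)_{b\in B}$. Then $$\overline{c\mathscr{A}(\mathcal{H}^c)}\;=\;\bigcup_{\mathcal{L}}c\mathscr{A}\bigl(\mathcal{H}(\mathcal{L})^c\bigr),$$ the union over all flags $\mathcal{L}$ of flats of $\mathcal{H}$.
   Context: $\mathbb{T}\subset\mathbb{C}$ is the unit circle; $\mathrm{Arg}\colon(\mathbb{C}^\times)^B\to\mathbb{T}^B$ is coordinatewise $z\mapsto z/|z|$; the coamoeba of $X\subset(\mathbb{C}^\times)^B$ is $c\mathscr{A}(X)=\mathrm{Arg}(X)$, and the bar is closure in $\mathbb{T}^B$. A flat of $\mathcal{H}$ is a linear subspace of $V$ that is an intersection of hyperplanes of $\mathcal{H}$ (including $V$, the empty intersection, and $\{0\}$). A flag of flats is a chain $\mathcal{L}=(\{0\}=L_0\subsetneq L_1\subsetneq\dots\subsetneq L_k\subsetneq L_{k+1}=V)$ of flats with $k\ge 0$ (for $k=0$ it is $\{0\}\subsetneq V$). Put $F_i:=\{b\in B: b|_{L_i}\equiv0\}$, so $B=F_0\supsetneq F_1\supsetneq\dots\supsetneq F_{k+1}=\emptyset$. For $1\le i\le k+1$ the forms in $F_{i-1}\smallsetminus F_i$ induce an arrangement $(\mathcal{H}/L_{i-1})|_{L_i}$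 in $L_i/L_{i-1}$; let $((\mathcal{H}/L_{i-1})|_{L_i})^c\subset(\mathbb{C}^\times)^{F_{i-1}\smallsetminus F_i}$ be the image of its complement under $v\mapsto(\langle b,v\rangle)_{b\in F_{i-1}\smallsetminus F_i}$. Define $$\mathcal{H}(\mathcal{L})^c:=\prod_{i=1}^{k+1}\bigl((\mathcal{H}/L_{i-1})|_{L_i}\bigr)^c\subset\prod_{i=1}^{k+1}(\mathbb{C}^\times)^{F_{i-1}\smallsetminus F_i}=(\mathbb{C}^\times)^B.$$ *)

theory Defs
  imports "HOL-Analysis.Analysis" "HOL-Library.Function_Algebras"
begin

text \<open>
  The space \<open>V\<close> is the whole type \<open>'v\<close>, with complex scalar multiplication \<open>scl\<close>.
  A finite multiset of linear forms on \<open>V\<close> is given as a family \<open>\<beta> b\<close> indexed by a finite set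
  \<open>B\<close>; repeated forms are allowed, as \<open>\<beta>\<close> need not be injective on \<open>B\<close>.
  Points of a power indexed by \<open>J\<close> are functions in \<^term>\<open>PiE J\<close>, i.e. undefined outside \<open>J\<close>.
\<close>

definition dual_space :: "(complex \<Rightarrow> 'v \<Rightarrow> 'v::ab_group_add) \<Rightarrow> ('v \<Rightarrow> complex) set" where
  "dual_space scl = {f. Vector_Spaces.linear scl (*) f}"

definition form_scale :: "complex \<Rightarrow> ('v \<Rightarrow> complex) \<Rightarrow> 'v \<Rightarrow> complex" where
  "form_scale c f = (\<lambda>v. c * f v)"

lemma vector_space_form_scale: "vector_space form_scale"
  by unfold_locales (simp_all add: form_scale_def plus_fun_def distrib_left distrib_right mult.assoc)

definition torus :: "'b set \<Rightarrow> ('b \<Rightarrow> complex) topology" where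
  "torus B = product_topology (\<lambda>_. top_of_set (sphere 0 1)) B"

definition Arg_map :: "'b set \<Rightarrow> ('b \<Rightarrow> complex) \<Rightarrow> 'b \<Rightarrow> complex" where
  "Arg_map B z = (\<lambda>b\<in>B. z b / complex_of_real (cmod (z b)))"

definition coamoeba :: "'b set \<Rightarrow> ('b \<Rightarrow> complex) set \<Rightarrow> ('b \<Rightarrow> complex) set" where
  "coamoeba B X = Arg_map B ` X"

text \<open>
  Here \<open>X\<close> is the ambient vector space; it is \<open>V\<close> itself or a subquotient of \<open>V\<close>
  whose points are cosets.
\<close>

definition arrangement :: "'x set \<Rightarrow> 'b set \<Rightarrow> ('b \<Rightarrow> 'x \<Rightarrow> complex) \<Rightarrow> 'x set set" where
  "arrangement X J \<phi> = (\<lambda>b. {x \<in> X. \<phi> b x = 0}) ` J"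

definition complement_image :: "'x set \<Rightarrow> 'b set \<Rightarrow> ('b \<Rightarrow> 'x \<Rightarrow> complex) \<Rightarrow> ('b \<Rightarrow> complex) set" where
  "complement_image X J \<phi> = (\<lambda>x. \<lambda>b\<in>J. \<phi> b x) ` (X - \<Union> (arrangement X J \<phi>))"

definition is_flat :: "'b set \<Rightarrow> ('b \<Rightarrow> 'v \<Rightarrow> complex) \<Rightarrow> 'v set \<Rightarrow> bool" where
  "is_flat B \<beta> L \<longleftrightarrow> (\<exists>S \<subseteq> arrangement UNIV B \<beta>. L = \<Inter> S)"

text \<open>Only the values \<open>L 0, \<dots>, L (k + 1)\<close> of \<open>L\<close> are relevant.\<close>

definition is_flag :: "'b set \<Rightarrow> ('b \<Rightarrow> 'v::zero \<Rightarrow> complex) \<Rightarrow> nat \<Rightarrow> (nat \<Rightarrow> 'v set) \<Rightarrow> bool" where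
  "is_flag B \<beta> k L \<longleftrightarrow>
     (\<forall>i \<le> k + 1. is_flat B \<beta> (L i)) \<and> L 0 = {0} \<and> L (k + 1) = UNIV \<and>
     (\<forall>i \<le> k. L i \<subset> L (i + 1))"

definition vanishing :: "'b set \<Rightarrow> ('b \<Rightarrow> 'v \<Rightarrow> complex) \<Rightarrow> 'v set \<Rightarrow> 'b set" where
  "vanishing B \<beta> L = {b \<in> B. \<forall>v \<in> L. \<beta> b v = 0}"

definition quotient_space :: "'v::ab_group_add set \<Rightarrow> 'v set \<Rightarrow> 'v set set" where
  "quotient_space M L = M // {(x, y). x - y \<in> L}"

text \<open>
  A form vanishing on \<open>L\<close> is constant on every coset \<open>C\<close> of \<open>L\<close>; the induced form takes this
  constant value at \<open>C\<close>.
\<close>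

definition induced_form :: "('v \<Rightarrow> complex) \<Rightarrow> 'v set \<Rightarrow> complex" where
  "induced_form f C = the_elem (f ` C)"

lemma induced_form_coset:
  assumes "Vector_Spaces.linear scl (*) f" "\<forall>v \<in> L. f v = 0" "0 \<in> L"
  shows "induced_form f ({(x, y). x - y \<in> L} `` {v}) = f v"
proof -
  interpret Vector_Spaces.linear scl "(*)" f by fact
  have "f y = f v" if "v - y \<in> L" for y
    using assms(2) that diff[of v y] by simp
  moreover have "v - v \<in> L"
    using assms(3) by simp
  ultimately have "f ` ({(x, y). x - y \<in> L} `` {v}) = {f v}"
    by blast
  then show ?thesis by (simp add: induced_form_def)
qed

text \<open>
  The product over the blocks is taken inside the power indexed by \<open>B\<close>, by requiring the
  restriction to each block to lie in the corresponding factor.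
\<close>

definition flag_complement_image ::
  "'b set \<Rightarrow> ('b \<Rightarrow> 'v::ab_group_add \<Rightarrow> complex) \<Rightarrow> nat \<Rightarrow> (nat \<Rightarrow> 'v set) \<Rightarrow> ('b \<Rightarrow> complex) set" where
  "flag_complement_image B \<beta> k L =
     {z \<in> B \<rightarrow>\<^sub>E (UNIV - {0}). \<forall>i \<in> {1..k + 1}.
        let J = vanishing B \<beta> (L (i - 1)) - vanishing B \<beta> (L i)
        in restrict z J \<in>
             complement_image (quotient_space (L i) (L (i - 1))) J (\<lambda>b. induced_form (\<beta> b))}"

end

theory Submission imports Defs begin

text \<open>
  Write \<open>Arg z\<close> for \<open>sgn z\<close>. A point \<open>\<theta>\<close> of the torus lies in the part of the right hand side
  belonging to a flag \<open>L\<close> iff there are vectors \<open>u i \<in> L (i + 1)\<close> such that \<open>\<theta> b = Arg (\<beta> b (u i))\<close>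
  for the forms \<open>b\<close> that vanish on \<open>L i\<close> but not on \<open>L (i + 1)\<close>; every form belongs to exactly
  one such block.

  Such a point is a limit of the coamoeba: on the curve \<open>v t = u 0 + t u 1 + \<dots> + t ^ k u k\<close> a
  form \<open>b\<close> of block \<open>i\<close> kills the terms before the \<open>i\<close>th, so the \<open>i\<close>th term dominates and
  \<open>Arg (\<beta> b (v t))\<close> tends to \<open>\<theta> b\<close> as the real number \<open>t > 0\<close> tends to \<open>0\<close>.

  Conversely, let \<open>\<theta>\<close> be a limit of the coamoeba. For every nonempty set \<open>F\<close> of forms there are
  vectors \<open>v n\<close> such that \<open>Arg (\<beta> b (v n))\<close> tends to \<open>\<theta> b\<close> for \<open>b \<in> F\<close>. Rescaling makes the tuple
  \<open>(\<beta> b (v n))\<close>, \<open>b \<in> F\<close>, a unit vector for the \<open>1\<close>-norm, so a subsequence converges to a nonzero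
  tuple, and this is the tuple of some vector \<open>w\<close> because a linear image of a vector space in a
  finite power of the complex numbers is closed. The arguments of \<open>w\<close> are then the right ones for
  every \<open>b \<in> F\<close> that does not vanish at \<open>w\<close> (\<open>arguments_of_limit_vector\<close>).
  Applied to the set \<open>F\<close> of forms vanishing on a flat \<open>L \<noteq> V\<close>, this
  gives the next flat of the flag: the common kernel of the forms in \<open>F\<close> vanishing at \<open>w\<close>. Starting
  from \<open>{0}\<close> and repeating until no forms are left yields the flag (\<open>flag_above_flat\<close>).
\<close>

section \<open>Values of finitely many linear forms\<close>

lemma linear_form_simps:
  assumes "Vector_Spaces.linear scl (*) f"
  shows "f (x + y) = f x + f y" "f (x - y) = f x - f y" "f (scl c x) = c * f x" "f 0 = 0"
    "f (sum g A) = (\<Sum>a\<in>A. f (g a))"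
proof -
  interpret Vector_Spaces.linear scl "(*)" f by fact
  show "f (x + y) = f x + f y" "f (x - y) = f x - f y" "f (scl c x) = c * f x" "f 0 = 0"
    "f (sum g A) = (\<Sum>a\<in>A. f (g a))"
    by (simp_all add: add diff scale sum)
qed

lemma linear_form_diff_scaled:
  assumes "Vector_Spaces.linear scl (*) f" "Vector_Spaces.linear scl (*) g"
  shows "Vector_Spaces.linear scl (*) (\<lambda>x. f x - a * g x)"
proof -
  interpret f: Vector_Spaces.linear scl "(*)" f by fact
  interpret g: Vector_Spaces.linear scl "(*)" g by fact
  show ?thesis
    by unfold_locales (simp_all add: f.add g.add f.scale g.scale algebra_simps)
qed

text \<open>
  Induction on \<open>F\<close>. If the new form \<open>\<phi> d\<close> is nonzero at some \<open>u\<close> in the common kernel of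
  the others, subtracting a multiple of \<open>\<phi> d\<close> from \<open>f\<close> gives a form that vanishes at \<open>u\<close>, and hence on
  the whole common kernel of the others; if not, \<open>\<phi> d\<close> does not change the common kernel.
\<close>
lemma linear_form_combination_if_kernel:
  assumes "finite F" "\<And>b. b \<in> F \<Longrightarrow> Vector_Spaces.linear scl (*) (\<phi> b)"
    and "Vector_Spaces.linear scl (*) f" "\<And>v. (\<And>b. b \<in> F \<Longrightarrow> \<phi> b v = 0) \<Longrightarrow> f v = 0"
  shows "\<exists>a. \<forall>v. f v = (\<Sum>b\<in>F. a b * \<phi> b v)"
  using assms
proof (induction F arbitrary: f rule: finite_induct)
  case empty
  then show ?case by simp
next
  case (insert d F)
  have lin_d: "Vector_Spaces.linear scl (*) (\<phi> d)"
    using insert.prems(1) by simp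
  have combine: "\<exists>a. \<forall>v. f v = (\<Sum>b\<in>insert d F. a b * \<phi> b v)"
    if "\<forall>v. f v - c * \<phi> d v = (\<Sum>b\<in>F. a b * \<phi> b v)" for a c
  proof (intro exI allI)
    fix v
    have "(\<Sum>b\<in>F. (a(d := c)) b * \<phi> b v) = (\<Sum>b\<in>F. a b * \<phi> b v)"
      using insert.hyps by (intro sum.cong) auto
    then show "f v = (\<Sum>b\<in>insert d F. (a(d := c)) b * \<phi> b v)"
      using that[rule_format, of v] insert.hyps by (simp add: algebra_simps)
  qed
  show ?case
  proof (cases "\<exists>u. (\<forall>b\<in>F. \<phi> b u = 0) \<and> \<phi> d u \<noteq> 0")
    case True
    then obtain u where u: "\<forall>b\<in>F. \<phi> b u = 0" "\<phi> d u \<noteq> 0" by blast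
    define c where "c = f u / \<phi> d u"
    have "f v - c * \<phi> d v = 0" if "\<And>b. b \<in> F \<Longrightarrow> \<phi> b v = 0" for v
    proof -
      let ?x = "v - scl (\<phi> d v / \<phi> d u) u"
      have "\<phi> b ?x = 0" if "b \<in> insert d F" for b
        using that u \<open>\<And>b. b \<in> F \<Longrightarrow> \<phi> b v = 0\<close> insert.prems(1)[OF that]
        by (auto simp: linear_form_simps)
      then have "f ?x = 0"
        by (rule insert.prems(3))
      then show ?thesis
        using u(2) by (simp add: linear_form_simps[OF insert.prems(2)] c_def field_simps)
    qed
    then have "\<exists>a. \<forall>v. f v - c * \<phi> d v = (\<Sum>b\<in>F. a b * \<phi> b v)"
      using insert.prems(1,2) lin_d by (intro insert.IH linear_form_diff_scaled) auto
    then show ?thesis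
      using combine by blast
  next
    case False
    then have "f v = 0" if "\<And>b. b \<in> F \<Longrightarrow> \<phi> b v = 0" for v
      using that insert.prems(3)[of v] by blast
    with insert.IH[of f] insert.prems show ?thesis
      using combine[of 0] by auto
  qed
qed

text \<open>
  The image of a vector space under finitely many linear forms is closed. In the induction, either
  the value of the new form can be changed independently of the others, or it is a
  combination of the others and the limits obey the same relation.
\<close>
lemma limit_of_linear_form_values:
  fixes \<phi> :: "'b \<Rightarrow> 'v::ab_group_add \<Rightarrow> complex"
  assumes "finite F" "\<And>b. b \<in> F \<Longrightarrow> Vector_Spaces.linear scl (*) (\<phi> b)"
    and "\<And>b. b \<in> F \<Longrightarrow> (\<lambda>n. \<phi> b (v n)) \<longlonglongrightarrow> y b"
  shows "\<exists>w. \<forall>b\<in>F. \<phi> b w = y b"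
  using assms
proof (induction F rule: finite_induct)
  case empty
  then show ?case by simp
next
  case (insert d F)
  have lin_d: "Vector_Spaces.linear scl (*) (\<phi> d)"
    using insert.prems(1) by simp
  obtain w where w: "\<And>b. b \<in> F \<Longrightarrow> \<phi> b w = y b"
    using insert by auto
  show ?case
  proof (cases "\<exists>u. (\<forall>b\<in>F. \<phi> b u = 0) \<and> \<phi> d u \<noteq> 0")
    case True
    then obtain u where u: "\<forall>b\<in>F. \<phi> b u = 0" "\<phi> d u \<noteq> 0" by blast
    have "\<phi> b (w + scl ((y d - \<phi> d w) / \<phi> d u) u) = y b" if "b \<in> insert d F" for b
      using that u w insert.prems(1)[OF that] by (auto simp: linear_form_simps)
    then show ?thesis by blast
  next
    case False
    then obtain a where a: "\<And>v. \<phi> d v = (\<Sum>b\<in>F. a b * \<phi> b v)"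
      using linear_form_combination_if_kernel[of F scl \<phi> "\<phi> d"] insert.hyps insert.prems(1) by blast
    have "(\<lambda>n. \<phi> d (v n)) \<longlonglongrightarrow> (\<Sum>b\<in>F. a b * y b)"
      unfolding a by (intro tendsto_sum tendsto_mult tendsto_const insert.prems(2)) simp
    moreover have "(\<lambda>n. \<phi> d (v n)) \<longlonglongrightarrow> y d"
      using insert.prems(2) by simp
    ultimately have "y d = (\<Sum>b\<in>F. a b * y b)"
      using LIMSEQ_unique by blast
    with w have "\<forall>b\<in>insert d F. \<phi> b w = y b" by (simp add: a)
    then show ?thesis ..
  qed
qed

lemma bounded_family_convergent_subseq:
  fixes x :: "nat \<Rightarrow> 'b \<Rightarrow> complex"
  assumes "finite F" and "\<And>n b. b \<in> F \<Longrightarrow> cmod (x n b) \<le> C"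
  obtains r :: "nat \<Rightarrow> nat" and y where "strict_mono r" "\<And>b. b \<in> F \<Longrightarrow> (\<lambda>n. x (r n) b) \<longlonglongrightarrow> y b"
proof -
  have "bounded ((\<lambda>z. z b) ` range x)" if "b \<in> F" for b
    using assms(2)[OF that] by (intro boundedI[of _ C]) auto
  then have "\<forall>d\<subseteq>F. \<exists>y r. strict_mono (r :: nat \<Rightarrow> nat) \<and>
      (\<forall>e>0. \<forall>\<^sub>F n in sequentially. \<forall>b\<in>d. dist (x (r n) b) (y b) < e)"
    using assms(1) by (intro compact_lemma_general[where unproj = "\<lambda>z. z"]) auto
  then obtain y and r :: "nat \<Rightarrow> nat" where r: "strict_mono r"
    and y: "\<And>e. e > 0 \<Longrightarrow> \<forall>\<^sub>F n in sequentially. \<forall>b\<in>F. dist (x (r n) b) (y b) < e"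
    by blast
  have "(\<lambda>n. x (r n) b) \<longlonglongrightarrow> y b" if "b \<in> F" for b
    unfolding tendsto_iff
  proof (intro allI impI)
    fix e :: real assume "e > 0"
    from y[OF this] show "\<forall>\<^sub>F n in sequentially. dist (x (r n) b) (y b) < e"
      by eventually_elim (use that in blast)
  qed
  with r that show ?thesis by blast
qed

text \<open>
  Dividing each approximating vector by the sum of the \<open>\<bar>\<phi> b v\<bar>\<close> keeps the arguments and prevents
  the limit from vanishing at all forms. The limit may still vanish at some of them, and there
  the argument is lost.
\<close>
lemma arguments_of_limit_vector:
  fixes \<phi> :: "'b \<Rightarrow> 'v::ab_group_add \<Rightarrow> complex"
  assumes F: "finite F" "F \<noteq> {}" "\<And>b. b \<in> F \<Longrightarrow> Vector_Spaces.linear scl (*) (\<phi> b)"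
    and near: "\<And>e. e > 0 \<Longrightarrow> \<exists>v. \<forall>b\<in>F. \<phi> b v \<noteq> 0 \<and> dist (sgn (\<phi> b v)) (\<theta> b) < e"
  obtains w where "\<exists>b\<in>F. \<phi> b w \<noteq> 0" "\<And>b. b \<in> F \<Longrightarrow> \<phi> b w \<noteq> 0 \<Longrightarrow> sgn (\<phi> b w) = \<theta> b"
proof -
  have "\<exists>v. (\<forall>b\<in>F. dist (sgn (\<phi> b v)) (\<theta> b) < inverse (real (Suc n))) \<and> (\<Sum>b\<in>F. cmod (\<phi> b v)) = 1"
    for n
  proof -
    obtain v where v: "\<And>b. b \<in> F \<Longrightarrow> \<phi> b v \<noteq> 0"
      "\<And>b. b \<in> F \<Longrightarrow> dist (sgn (\<phi> b v)) (\<theta> b) < inverse (real (Suc n))"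
      using near[of "inverse (real (Suc n))"] by auto
    define s where "s = (\<Sum>b\<in>F. cmod (\<phi> b v))"
    have "s > 0"
      unfolding s_def using F v(1) by (intro sum_pos) auto
    define w where "w = scl (of_real (inverse s)) v"
    have eq: "\<phi> b w = of_real (inverse s) * \<phi> b v" if "b \<in> F" for b
      by (simp only: w_def linear_form_simps[OF F(3)[OF that]])
    have sgn: "sgn (\<phi> b w) = sgn (\<phi> b v)" if "b \<in> F" for b
      unfolding eq[OF that] sgn_mult sgn_of_real using \<open>s > 0\<close> by simp
    have "(\<Sum>b\<in>F. cmod (\<phi> b w)) = (\<Sum>b\<in>F. inverse s * cmod (\<phi> b v))"
      using \<open>s > 0\<close> by (intro sum.cong) (auto simp: eq norm_mult norm_inverse)
    also have "\<dots> = 1"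
      using \<open>s > 0\<close> by (simp add: sum_distrib_left[symmetric] s_def[symmetric])
    finally have "(\<Sum>b\<in>F. cmod (\<phi> b w)) = 1" .
    moreover have "\<forall>b\<in>F. dist (sgn (\<phi> b w)) (\<theta> b) < inverse (real (Suc n))"
      using v(2) sgn by simp
    ultimately show ?thesis by blast
  qed
  then obtain v where
    v: "\<And>n b. b \<in> F \<Longrightarrow> dist (sgn (\<phi> b (v n))) (\<theta> b) < inverse (real (Suc n))"
    and v1: "\<And>n. (\<Sum>b\<in>F. cmod (\<phi> b (v n))) = 1"
    by metis
  have "cmod (\<phi> b (v n)) \<le> 1" if "b \<in> F" for n b
    unfolding v1[of n, symmetric] using that F(1) by (intro member_le_sum) auto
  then obtain r :: "nat \<Rightarrow> nat" and y where r: "strict_mono r"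
    and y: "\<And>b. b \<in> F \<Longrightarrow> (\<lambda>n. \<phi> b (v (r n))) \<longlonglongrightarrow> y b"
    using bounded_family_convergent_subseq[of F "\<lambda>n b. \<phi> b (v n)" 1] F(1) by blast
  obtain w where w: "\<And>b. b \<in> F \<Longrightarrow> \<phi> b w = y b"
    using limit_of_linear_form_values[of F scl \<phi> "\<lambda>n. v (r n)" y] F y by blast
  have "(\<lambda>n. \<Sum>b\<in>F. cmod (\<phi> b (v (r n)))) \<longlonglongrightarrow> (\<Sum>b\<in>F. cmod (y b))"
    using y by (intro tendsto_intros) auto
  then have "(\<Sum>b\<in>F. cmod (y b)) = 1"
    by (simp add: v1 LIMSEQ_const_iff)
  then have "\<exists>b\<in>F. \<phi> b w \<noteq> 0"
    using w by (metis norm_zero sum.neutral zero_neq_one)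
  moreover have "sgn (\<phi> b w) = \<theta> b" if b: "b \<in> F" "\<phi> b w \<noteq> 0" for b
  proof -
    have "(\<lambda>n. sgn (\<phi> b (v n))) \<longlonglongrightarrow> \<theta> b"
      by (rule metric_tendsto_imp_tendsto[OF LIMSEQ_inverse_real_of_nat])
        (use v[OF b(1)] in \<open>auto intro!: always_eventually less_imp_le\<close>)
    then have "(\<lambda>n. sgn (\<phi> b (v (r n)))) \<longlonglongrightarrow> \<theta> b"
      using r by (auto dest: LIMSEQ_subseq_LIMSEQ simp: o_def)
    moreover have "(\<lambda>n. sgn (\<phi> b (v (r n)))) \<longlonglongrightarrow> sgn (\<phi> b w)"
      using y[OF b(1)] w[OF b(1)] b(2) by (intro tendsto_sgn) auto
    ultimately show ?thesis
      using LIMSEQ_unique by blast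
  qed
  ultimately show ?thesis
    using that by blast
qed

section \<open>Closure in the torus\<close>

lemma in_closure_of_torus_iff:
  assumes "finite B" and S: "S \<subseteq> B \<rightarrow>\<^sub>E sphere 0 1"
  shows "\<theta> \<in> torus B closure_of S \<longleftrightarrow>
    \<theta> \<in> B \<rightarrow>\<^sub>E sphere 0 1 \<and> (\<forall>e>0. \<exists>z\<in>S. \<forall>b\<in>B. dist (z b) (\<theta> b) < e)"
    (is "_ \<longleftrightarrow> ?R")
proof
  assume L: "\<theta> \<in> torus B closure_of S"
  then have \<theta>: "\<theta> \<in> B \<rightarrow>\<^sub>E sphere 0 1"
    by (auto simp: in_closure_of torus_def)
  have "\<exists>z\<in>S. \<forall>b\<in>B. dist (z b) (\<theta> b) < e" if "e > 0" for e
  proof -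
    let ?T = "\<Pi>\<^sub>E b\<in>B. sphere 0 1 \<inter> ball (\<theta> b) e"
    have "openin (torus B) ?T"
      unfolding torus_def using assms(1) by (subst openin_PiE) (auto intro: openin_open_Int)
    moreover have "\<theta> \<in> ?T"
      using \<theta> that by (auto simp: PiE_iff)
    ultimately obtain z where "z \<in> S" "z \<in> ?T"
      using L by (auto simp: in_closure_of)
    then show ?thesis
      by (intro bexI[of _ z]) (auto simp: PiE_iff dist_commute)
  qed
  with \<theta> show ?R by blast
next
  assume R: ?R
  have *: "\<exists>z\<in>S. z \<in> T" if T: "openin (torus B) T" "\<theta> \<in> T" for T
  proof -
    obtain U where U: "\<And>b. b \<in> B \<Longrightarrow> openin (top_of_set (sphere 0 1)) (U b)"
      "\<theta> \<in> Pi\<^sub>E B U" "Pi\<^sub>E B U \<subseteq> T"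
      using T unfolding torus_def openin_product_topology_alt by (meson)
    have "\<exists>e>0. \<forall>x\<in>sphere 0 1. dist x (\<theta> b) < e \<longrightarrow> x \<in> U b" if "b \<in> B" for b
    proof -
      have "\<theta> b \<in> U b" using U(2) that by auto
      with U(1)[OF that] show ?thesis unfolding openin_euclidean_subtopology_iff by blast
    qed
    then obtain d where d: "\<And>b. b \<in> B \<Longrightarrow> d b > 0"
      "\<And>b x. b \<in> B \<Longrightarrow> x \<in> sphere 0 1 \<Longrightarrow> dist x (\<theta> b) < d b \<Longrightarrow> x \<in> U b"
      by metis
    \<comment> \<open>The element \<open>1\<close> covers the case of empty \<open>B\<close>.\<close>
    define e where "e = Min (insert 1 (d ` B))"
    have "e > 0" "\<And>b. b \<in> B \<Longrightarrow> e \<le> d b"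
      using assms(1) d(1) by (auto simp: e_def)
    then obtain z where z: "z \<in> S" "\<And>b. b \<in> B \<Longrightarrow> dist (z b) (\<theta> b) < d b"
      using R by (meson less_le_trans)
    have "z \<in> B \<rightarrow>\<^sub>E sphere 0 1"
      using z(1) S by blast
    then have "z \<in> Pi\<^sub>E B U"
      unfolding PiE_iff using z(2) d(2) by blast
    with U(3) z(1) show ?thesis by blast
  qed
  have "\<theta> \<in> topspace (torus B)"
    using R by (simp add: torus_def)
  with * show "\<theta> \<in> torus B closure_of S"
    unfolding in_closure_of by blast
qed

lemma Arg_map_eq_sgn: "Arg_map B z = (\<lambda>b\<in>B. sgn (z b))"
  by (simp add: Arg_map_def sgn_eq)

section \<open>Flats and flags\<close>

locale essential_arrangement =
  fixes scl :: "complex \<Rightarrow> 'v::ab_group_add \<Rightarrow> 'v"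
    and B :: "'b set" and \<beta> :: "'b \<Rightarrow> 'v \<Rightarrow> complex"
  assumes finite_B: "finite B"
    and linear_\<beta>: "b \<in> B \<Longrightarrow> Vector_Spaces.linear scl (*) (\<beta> b)"
    and nonzero_\<beta>: "b \<in> B \<Longrightarrow> \<exists>v. \<beta> b v \<noteq> 0"
    and separating: "(\<And>b. b \<in> B \<Longrightarrow> \<beta> b v = 0) \<Longrightarrow> v = 0"
begin

lemmas \<beta>_simps = linear_form_simps[OF linear_\<beta>]

lemma mem_complement_coamoeba_iff:
  "z \<in> coamoeba B (complement_image UNIV B \<beta>) \<longleftrightarrow>
    (\<exists>v. (\<forall>b\<in>B. \<beta> b v \<noteq> 0) \<and> z = (\<lambda>b\<in>B. sgn (\<beta> b v)))"
  by (auto simp: coamoeba_def complement_image_def arrangement_def Arg_map_eq_sgn image_iff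
      cong: restrict_cong)

lemma closure_coamoeba_iff:
  "\<theta> \<in> torus B closure_of coamoeba B (complement_image UNIV B \<beta>) \<longleftrightarrow>
    \<theta> \<in> B \<rightarrow>\<^sub>E sphere 0 1 \<and>
    (\<forall>e>0. \<exists>v. \<forall>b\<in>B. \<beta> b v \<noteq> 0 \<and> dist (sgn (\<beta> b v)) (\<theta> b) < e)"
proof -
  have "coamoeba B (complement_image UNIV B \<beta>) \<subseteq> B \<rightarrow>\<^sub>E sphere 0 1"
    by (auto simp: mem_complement_coamoeba_iff norm_sgn)
  moreover have "(\<exists>z\<in>coamoeba B (complement_image UNIV B \<beta>). \<forall>b\<in>B. dist (z b) (\<theta> b) < e) \<longleftrightarrow>
      (\<exists>v. \<forall>b\<in>B. \<beta> b v \<noteq> 0 \<and> dist (sgn (\<beta> b v)) (\<theta> b) < e)" for e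
    unfolding Bex_def mem_complement_coamoeba_iff by force
  ultimately show ?thesis
    using in_closure_of_torus_iff[OF finite_B] by simp
qed

lemma is_flat_kernel:
  assumes "F \<subseteq> B"
  shows "is_flat B \<beta> {v. \<forall>b\<in>F. \<beta> b v = 0}"
  unfolding is_flat_def
  using assms by (intro exI[of _ "(\<lambda>b. {v. \<beta> b v = 0}) ` F"]) (auto simp: arrangement_def)

lemma flat_eq_kernel_of_vanishing:
  assumes "is_flat B \<beta> L"
  shows "L = {v. \<forall>b\<in>vanishing B \<beta> L. \<beta> b v = 0}"
proof
  obtain S where S: "S \<subseteq> arrangement UNIV B \<beta>" "L = \<Inter> S"
    using assms by (auto simp: is_flat_def)
  show "{v. \<forall>b\<in>vanishing B \<beta> L. \<beta> b v = 0} \<subseteq> L"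
  proof
    fix v assume v: "v \<in> {v. \<forall>b\<in>vanishing B \<beta> L. \<beta> b v = 0}"
    have "v \<in> H" if "H \<in> S" for H
    proof -
      have "H \<in> arrangement UNIV B \<beta>" using S(1) that by blast
      then obtain b where "b \<in> B" "H = {x. \<beta> b x = 0}"
        by (auto simp: arrangement_def)
      moreover have "L \<subseteq> H" using S(2) that by blast
      ultimately show ?thesis using v by (auto simp: vanishing_def)
    qed
    then show "v \<in> L" using S(2) by blast
  qed
qed (auto simp: vanishing_def)

lemma flat_zero_mem: "is_flat B \<beta> L \<Longrightarrow> 0 \<in> L"
  by (subst flat_eq_kernel_of_vanishing) (auto simp: vanishing_def \<beta>_simps)

lemma is_flat_zero: "is_flat B \<beta> {0}"
proof -
  have "{v. \<forall>b\<in>B. \<beta> b v = 0} = {0}"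
    using separating by (auto simp: \<beta>_simps)
  with is_flat_kernel[of B] show ?thesis by simp
qed

lemma vanishing_UNIV: "vanishing B \<beta> UNIV = {}"
  using nonzero_\<beta> by (auto simp: vanishing_def)

lemma vanishing_antimono: "L \<subseteq> M \<Longrightarrow> vanishing B \<beta> M \<subseteq> vanishing B \<beta> L"
  by (auto simp: vanishing_def)

lemma flag_mono:
  assumes "is_flag B \<beta> k L" "i \<le> j" "j \<le> Suc k"
  shows "L i \<subseteq> L j"
  using assms(2,3)
proof (induction j rule: dec_induct)
  case (step n)
  then have "L n \<subset> L (Suc n)"
    using assms(1) by (simp add: is_flag_def)
  with step show ?case by auto
qed simp

abbreviation block :: "'v set \<Rightarrow> 'v set \<Rightarrow> 'b set" where
  "block L M \<equiv> vanishing B \<beta> L - vanishing B \<beta> M"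

lemma ex_flag_block:
  assumes L: "is_flag B \<beta> k L" and "b \<in> B"
  shows "\<exists>i\<le>k. b \<in> block (L i) (L (Suc i))"
proof -
  have top: "b \<notin> vanishing B \<beta> (L (Suc k))"
    using L by (simp add: is_flag_def vanishing_UNIV)
  have bot: "b \<in> vanishing B \<beta> (L 0)"
    using L \<open>b \<in> B\<close> by (simp add: is_flag_def vanishing_def \<beta>_simps)
  define m where "m = (LEAST m. b \<notin> vanishing B \<beta> (L m))"
  have m: "b \<notin> vanishing B \<beta> (L m)" "m \<le> Suc k" "\<And>i. i < m \<Longrightarrow> b \<in> vanishing B \<beta> (L i)"
    unfolding m_def by (rule LeastI[of _ "Suc k"], fact top)
      (use top in \<open>auto intro: Least_le dest: not_less_Least\<close>)
  then obtain i where "m = Suc i"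
    using bot by (cases m) auto
  with m show ?thesis by auto
qed

lemma flag_block_unique:
  assumes L: "is_flag B \<beta> k L" and ij: "i \<le> k" "j \<le> k"
    and b: "b \<in> block (L i) (L (Suc i))" "b \<in> block (L j) (L (Suc j))"
  shows "i = j"
proof -
  have False if "i < j" "j \<le> k" "b \<in> block (L i) (L (Suc i))" "b \<in> block (L j) (L (Suc j))" for i j
    using vanishing_antimono[OF flag_mono[OF L, of "Suc i" j]] that by auto
  with ij b show ?thesis by (meson linorder_neqE_nat)
qed

text \<open>
  The vector \<open>u\<close> represents a coset in \<open>M / L\<close> in the complement of the induced arrangement whose
  arguments are the coordinates of \<open>\<theta>\<close> in the corresponding block.
\<close>
definition realises :: "('b \<Rightarrow> complex) \<Rightarrow> 'v set \<Rightarrow> 'v set \<Rightarrow> 'v \<Rightarrow> bool" where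
  "realises \<theta> L M u \<longleftrightarrow> u \<in> M \<and> (\<forall>b\<in>block L M. \<beta> b u \<noteq> 0 \<and> sgn (\<beta> b u) = \<theta> b)"

lemma mem_quotient_complement_image_iff:
  assumes "0 \<in> L" "\<And>b. b \<in> block L M \<Longrightarrow> z b \<noteq> 0"
  shows "restrict z (block L M) \<in>
      complement_image (quotient_space M L) (block L M) (\<lambda>b. induced_form (\<beta> b)) \<longleftrightarrow>
    (\<exists>u\<in>M. \<forall>b\<in>block L M. z b = \<beta> b u)"
proof -
  define coset where "coset u = {(x, y). x - y \<in> L} `` {u}" for u
  have ind: "induced_form (\<beta> b) (coset u) = \<beta> b u" if "b \<in> block L M" for b u
    unfolding coset_def using that assms(1)
    by (intro induced_form_coset[OF linear_\<beta>]) (auto simp: vanishing_def)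
  have quot: "quotient_space M L = coset ` M"
    by (auto simp: quotient_space_def quotient_def coset_def)
  have restrict_eq: "restrict z (block L M) = (\<lambda>b\<in>block L M. induced_form (\<beta> b) (coset u))
      \<longleftrightarrow> (\<forall>b\<in>block L M. z b = \<beta> b u)" for u
    using ind[of _ u] unfolding fun_eq_iff restrict_def by metis
  have avoids: "coset u \<notin> \<Union> (arrangement (coset ` M) (block L M) (\<lambda>b. induced_form (\<beta> b)))"
    if "\<forall>b\<in>block L M. z b = \<beta> b u" for u
    using that ind[of _ u] assms(2) unfolding arrangement_def by fastforce
  have image_diff: "w \<in> f ` (coset ` M - A) \<longleftrightarrow> (\<exists>u\<in>M. coset u \<notin> A \<and> w = f (coset u))"
    for w :: "'b \<Rightarrow> complex" and f A
    by blast
  show ?thesis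
    unfolding quot complement_image_def image_diff restrict_eq
    by (intro bex_cong refl iffI conjI avoids) (erule conjunct2)
qed

text \<open>
  The factors of the product can be realised independently of each other, since the blocks
  partition \<open>B\<close>.
\<close>
lemma mem_flag_coamoeba_iff:
  assumes L: "is_flag B \<beta> k L"
  shows "\<theta> \<in> coamoeba B (flag_complement_image B \<beta> k L) \<longleftrightarrow>
    \<theta> \<in> extensional B \<and> (\<exists>u. \<forall>i\<le>k. realises \<theta> (L i) (L (Suc i)) (u i))"
proof -
  have zero: "0 \<in> L i" if "i \<le> Suc k" for i
    using L that by (intro flat_zero_mem) (auto simp: is_flag_def)
  have Ball_shift: "(\<forall>i\<in>{1..k + 1}. P i) \<longleftrightarrow> (\<forall>i\<le>k. P (Suc i))" for P
    by (metis Suc_eq_plus1 Suc_le_D Suc_le_mono atLeastAtMost_iff le_add2 One_nat_def)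
  have block_B: "block M N \<subseteq> B" for M N
    by (auto simp: vanishing_def)
  have mem: "z \<in> flag_complement_image B \<beta> k L \<longleftrightarrow> z \<in> B \<rightarrow>\<^sub>E (UNIV - {0}) \<and>
      (\<exists>u. \<forall>i\<le>k. u i \<in> L (Suc i) \<and> (\<forall>b\<in>block (L i) (L (Suc i)). z b = \<beta> b (u i)))" for z
  proof (cases "z \<in> B \<rightarrow>\<^sub>E (UNIV - {0})")
    case True
    then have "z b \<noteq> 0" if "b \<in> block M N" for b M N
      using that block_B by fastforce
    then have "restrict z (block (L i) (L (Suc i))) \<in>
          complement_image (quotient_space (L (Suc i)) (L i)) (block (L i) (L (Suc i)))
            (\<lambda>b. induced_form (\<beta> b)) \<longleftrightarrow>
        (\<exists>u\<in>L (Suc i). \<forall>b\<in>block (L i) (L (Suc i)). z b = \<beta> b u)" if "i \<le> k" for i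
      using zero[of i] that by (intro mem_quotient_complement_image_iff) simp_all
    then have "z \<in> flag_complement_image B \<beta> k L \<longleftrightarrow>
        (\<forall>i\<le>k. \<exists>u\<in>L (Suc i). \<forall>b\<in>block (L i) (L (Suc i)). z b = \<beta> b u)"
      unfolding flag_complement_image_def Let_def Ball_shift
      using True by simp
    also have "\<dots> \<longleftrightarrow> (\<exists>u. \<forall>i\<le>k. u i \<in> L (Suc i) \<and> (\<forall>b\<in>block (L i) (L (Suc i)). z b = \<beta> b (u i)))"
      by metis
    finally show ?thesis using True by simp
  qed (simp add: flag_complement_image_def)
  show ?thesis
  proof
    assume "\<theta> \<in> coamoeba B (flag_complement_image B \<beta> k L)"
    then obtain z u where z: "\<theta> = Arg_map B z" "z \<in> B \<rightarrow>\<^sub>E (UNIV - {0})"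
      "\<forall>i\<le>k. u i \<in> L (Suc i) \<and> (\<forall>b\<in>block (L i) (L (Suc i)). z b = \<beta> b (u i))"
      unfolding coamoeba_def mem[THEN eq_reflection] image_iff Bex_def by blast
    have "realises \<theta> (L i) (L (Suc i)) (u i)" if "i \<le> k" for i
      unfolding realises_def
    proof (intro conjI ballI)
      fix b assume b: "b \<in> block (L i) (L (Suc i))"
      then have "b \<in> B" "z b = \<beta> b (u i)"
        using block_B z(3) that by auto
      moreover have "z b \<noteq> 0" using z(2) \<open>b \<in> B\<close> by auto
      ultimately show "\<beta> b (u i) \<noteq> 0" "sgn (\<beta> b (u i)) = \<theta> b"
        by (simp_all add: z(1) Arg_map_eq_sgn)
    qed (use z(3) that in blast)
    then show "\<theta> \<in> extensional B \<and> (\<exists>u. \<forall>i\<le>k. realises \<theta> (L i) (L (Suc i)) (u i))"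
      using z(1) by (auto simp: Arg_map_eq_sgn)
  next
    assume "\<theta> \<in> extensional B \<and> (\<exists>u. \<forall>i\<le>k. realises \<theta> (L i) (L (Suc i)) (u i))"
    then obtain u where \<theta>: "\<theta> \<in> extensional B"
      and u: "\<And>i. i \<le> k \<Longrightarrow> realises \<theta> (L i) (L (Suc i)) (u i)" by blast
    obtain idx where idx: "\<And>b. b \<in> B \<Longrightarrow> idx b \<le> k \<and> b \<in> block (L (idx b)) (L (Suc (idx b)))"
      using ex_flag_block[OF L] by metis
    define z where "z = (\<lambda>b\<in>B. \<beta> b (u (idx b)))"
    have z: "z b \<noteq> 0 \<and> sgn (z b) = \<theta> b" if "b \<in> B" for b
      using idx[OF that] u[of "idx b"] that by (auto simp: z_def realises_def)
    have "z b = \<beta> b (u i)" if "i \<le> k" "b \<in> block (L i) (L (Suc i))" for i b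
    proof -
      have "b \<in> B" using that(2) block_B by blast
      then have "idx b = i"
        using flag_block_unique[OF L] idx that by blast
      with \<open>b \<in> B\<close> show ?thesis by (simp add: z_def)
    qed
    moreover have "z \<in> B \<rightarrow>\<^sub>E (UNIV - {0})"
      using z by (auto simp: z_def)
    ultimately have "z \<in> flag_complement_image B \<beta> k L"
      unfolding mem using u by (intro conjI exI[of _ u]) (auto simp: realises_def)
    moreover have "\<theta> = Arg_map B z"
      using \<theta> z by (auto simp: Arg_map_eq_sgn fun_eq_iff extensional_def)
    ultimately show "\<theta> \<in> coamoeba B (flag_complement_image B \<beta> k L)"
      by (auto simp: coamoeba_def)
  qed
qed

section \<open>Coamoebas of flags consist of limits\<close>

lemma flag_coamoeba_subset_closure:
  assumes L: "is_flag B \<beta> k L"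
  shows "coamoeba B (flag_complement_image B \<beta> k L) \<subseteq>
    torus B closure_of coamoeba B (complement_image UNIV B \<beta>)"
proof
  fix \<theta> assume "\<theta> \<in> coamoeba B (flag_complement_image B \<beta> k L)"
  then obtain u where ext: "\<theta> \<in> extensional B"
    and u: "\<And>i. i \<le> k \<Longrightarrow> realises \<theta> (L i) (L (Suc i)) (u i)"
    using mem_flag_coamoeba_iff[OF L] by blast
  define v where "v t = (\<Sum>j\<le>k. scl (of_real t ^ j) (u j))" for t :: real
  have *: "\<theta> b \<in> sphere 0 1 \<and>
      (\<forall>e>0. \<forall>\<^sub>F t in at_right 0. \<beta> b (v t) \<noteq> 0 \<and> dist (sgn (\<beta> b (v t))) (\<theta> b) < e)"
    if b: "b \<in> B" for b
  proof -
    obtain i where i: "i \<le> k" "b \<in> block (L i) (L (Suc i))"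
      using ex_flag_block[OF L b] by blast
    have ui: "\<beta> b (u i) \<noteq> 0" "sgn (\<beta> b (u i)) = \<theta> b"
      using u[OF i(1)] i(2) by (auto simp: realises_def)
    have small: "\<beta> b (u j) = 0" if "j < i" for j
    proof -
      have "u j \<in> L (Suc j)" using u[of j] that i(1) by (auto simp: realises_def)
      also have "\<dots> \<subseteq> L i" using that i(1) by (intro flag_mono[OF L]) auto
      finally show ?thesis using i(2) by (auto simp: vanishing_def)
    qed
    \<comment> \<open>For \<open>t > 0\<close> the argument ignores the factor \<open>t ^ i\<close>; what is left is continuous at \<open>0\<close>.\<close>
    define g where "g t = (\<Sum>j\<in>{i..k}. of_real t ^ (j - i) * \<beta> b (u j))" for t :: real
    have v_eq: "\<beta> b (v t) = of_real t ^ i * g t" for t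
    proof -
      have "\<beta> b (v t) = (\<Sum>j\<le>k. of_real t ^ j * \<beta> b (u j))"
        by (simp add: v_def \<beta>_simps[OF b])
      also have "\<dots> = (\<Sum>j\<in>{i..k}. of_real t ^ j * \<beta> b (u j))"
        using small by (intro sum.mono_neutral_right) auto
      also have "\<dots> = of_real t ^ i * g t"
        by (simp add: g_def sum_distrib_left mult.assoc[symmetric] power_add[symmetric])
      finally show ?thesis .
    qed
    have "g 0 = (\<Sum>j\<in>{i}. \<beta> b (u j))"
      unfolding g_def using i(1) by (intro sum.mono_neutral_cong_right) auto
    moreover have "isCont g 0"
      unfolding g_def by (intro continuous_intros)
    ultimately have g: "(g \<longlongrightarrow> \<beta> b (u i)) (at_right 0)"
      by (simp add: isCont_def filterlim_at_split)
    have pos: "\<forall>\<^sub>F t :: real in at_right 0. t > 0"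
      by (simp add: eventually_at_right_less)
    have "\<forall>\<^sub>F t in at_right 0. \<beta> b (v t) \<noteq> 0 \<and> dist (sgn (\<beta> b (v t))) (\<theta> b) < e" if "e > 0" for e
    proof -
      have "((\<lambda>t. sgn (g t)) \<longlongrightarrow> \<theta> b) (at_right 0)"
        using tendsto_sgn[OF g ui(1)] ui(2) by simp
      then have "\<forall>\<^sub>F t in at_right 0. dist (sgn (g t)) (\<theta> b) < e"
        using that by (rule tendstoD)
      moreover have "\<forall>\<^sub>F t in at_right 0. g t \<noteq> 0"
        by (rule tendsto_imp_eventually_ne[OF g ui(1)])
      ultimately show ?thesis
        using pos
      proof eventually_elim
        case (elim t)
        have "sgn (\<beta> b (v t)) = sgn (g t)"
          unfolding v_eq sgn_mult of_real_power[symmetric] sgn_of_real using elim by simp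
        then show ?case using elim by (simp add: v_eq)
      qed
    qed
    moreover have "\<theta> b \<in> sphere 0 1"
      using ui by (simp add: ui(2)[symmetric] norm_sgn)
    ultimately show ?thesis by blast
  qed
  have "\<exists>v. \<forall>b\<in>B. \<beta> b v \<noteq> 0 \<and> dist (sgn (\<beta> b v)) (\<theta> b) < e" if "e > 0" for e
  proof -
    have "\<forall>\<^sub>F t in at_right 0. \<forall>b\<in>B. \<beta> b (v t) \<noteq> 0 \<and> dist (sgn (\<beta> b (v t))) (\<theta> b) < e"
      using * that finite_B by (intro eventually_ball_finite) auto
    then show ?thesis
      using eventually_happens trivial_limit_at_right_real by blast
  qed
  with * ext show "\<theta> \<in> torus B closure_of coamoeba B (complement_image UNIV B \<beta>)"
    unfolding closure_coamoeba_iff by (auto simp: PiE_iff)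
qed

section \<open>Limits lie in coamoebas of flags\<close>

text \<open>
  Induction on the number of forms vanishing on \<open>L\<close>: the vector supplied by
  \<open>arguments_of_limit_vector\<close> for these forms determines the next flat \<open>N\<close>. The forms vanishing on
  \<open>N\<close> are exactly the ones whose argument the limit does not determine.
\<close>
lemma flag_above_flat:
  assumes near: "\<forall>e>0. \<exists>v. \<forall>b\<in>B. \<beta> b v \<noteq> 0 \<and> dist (sgn (\<beta> b v)) (\<theta> b) < e"
    and "is_flat B \<beta> L"
  shows "\<exists>m M u. M 0 = L \<and> M m = UNIV \<and> (\<forall>i\<le>m. is_flat B \<beta> (M i)) \<and>
    (\<forall>i<m. M i \<subset> M (Suc i) \<and> realises \<theta> (M i) (M (Suc i)) (u i))"
  using assms(2)
proof (induction "card (vanishing B \<beta> L)" arbitrary: L rule: less_induct)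
  case less
  let ?F = "vanishing B \<beta> L"
  have fin: "finite ?F" and FB: "?F \<subseteq> B"
    using finite_B by (auto simp: vanishing_def)
  have L_eq: "L = {v. \<forall>b\<in>?F. \<beta> b v = 0}"
    using less.prems by (rule flat_eq_kernel_of_vanishing)
  show ?case
  proof (cases "?F = {}")
    case True
    with L_eq have "L = UNIV" by simp
    with less.prems show ?thesis
      by (intro exI[of _ 0] exI[of _ "\<lambda>_. L"]) auto
  next
    case False
    obtain w where w: "\<exists>b\<in>?F. \<beta> b w \<noteq> 0" "\<And>b. b \<in> ?F \<Longrightarrow> \<beta> b w \<noteq> 0 \<Longrightarrow> sgn (\<beta> b w) = \<theta> b"
    proof (rule arguments_of_limit_vector[of ?F scl \<beta> \<theta>])
      show "\<exists>v. \<forall>b\<in>?F. \<beta> b v \<noteq> 0 \<and> dist (sgn (\<beta> b v)) (\<theta> b) < e" if "e > 0" for e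
        using near that FB by blast
    qed (use fin False FB linear_\<beta> in auto)
    define G where "G = {b \<in> ?F. \<beta> b w = 0}"
    define N where "N = {v. \<forall>b\<in>G. \<beta> b v = 0}"
    have "G \<subset> ?F" using w(1) by (auto simp: G_def)
    have "w \<in> N" "w \<notin> L"
      using w(1) by (auto simp: N_def G_def vanishing_def)
    moreover have "L \<subseteq> N"
      by (auto simp: N_def G_def vanishing_def)
    ultimately have "L \<subset> N" by blast
    have van_N: "vanishing B \<beta> N = G"
    proof
      show "vanishing B \<beta> N \<subseteq> G"
        using vanishing_antimono[OF \<open>L \<subseteq> N\<close>] \<open>w \<in> N\<close> by (auto simp: G_def vanishing_def)
      show "G \<subseteq> vanishing B \<beta> N"
        using FB by (auto simp: vanishing_def G_def N_def)
    qed
    have flat_N: "is_flat B \<beta> N"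
      unfolding N_def using FB by (intro is_flat_kernel) (auto simp: G_def)
    have "card (vanishing B \<beta> N) < card ?F"
      unfolding van_N using fin \<open>G \<subset> ?F\<close> by (rule psubset_card_mono)
    from less.hyps[OF this flat_N] obtain m M u where
      M: "M 0 = N" "M m = UNIV" "\<And>i. i \<le> m \<Longrightarrow> is_flat B \<beta> (M i)"
      "\<And>i. i < m \<Longrightarrow> M i \<subset> M (Suc i) \<and> realises \<theta> (M i) (M (Suc i)) (u i)"
      by blast
    have step: "realises \<theta> L N w"
      unfolding realises_def van_N using \<open>w \<in> N\<close> w(2) by (auto simp: G_def)
    show ?thesis
    proof (intro exI conjI allI impI)
      let ?M = "case_nat L M"
      show "?M 0 = L" "?M (Suc m) = UNIV" using M by simp_all
      show "is_flat B \<beta> (?M i)" if "i \<le> Suc m" for i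
        using that M(3) less.prems by (cases i) auto
      show "?M i \<subset> ?M (Suc i)" if "i < Suc m" for i
        using that M(1,4) \<open>L \<subset> N\<close> by (cases i) auto
      show "realises \<theta> (?M i) (?M (Suc i)) (case_nat w u i)" if "i < Suc m" for i
        using that M(1,4) step by (cases i) auto
    qed
  qed
qed

lemma closure_subset_flag_coamoebas:
  assumes "\<exists>v::'v. v \<noteq> 0"
    and "\<theta> \<in> torus B closure_of coamoeba B (complement_image UNIV B \<beta>)"
  shows "\<exists>k L. is_flag B \<beta> k L \<and> \<theta> \<in> coamoeba B (flag_complement_image B \<beta> k L)"
proof -
  have \<theta>: "\<theta> \<in> B \<rightarrow>\<^sub>E sphere 0 1"
    and near: "\<forall>e>0. \<exists>v. \<forall>b\<in>B. \<beta> b v \<noteq> 0 \<and> dist (sgn (\<beta> b v)) (\<theta> b) < e"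
    using assms(2) unfolding closure_coamoeba_iff by blast+
  from flag_above_flat[OF near is_flat_zero] obtain m M u where
    M: "M 0 = {0}" "M m = UNIV" "\<forall>i\<le>m. is_flat B \<beta> (M i)"
    "\<forall>i<m. M i \<subset> M (Suc i) \<and> realises \<theta> (M i) (M (Suc i)) (u i)"
    by (elim exE conjE) (rule that)
  have "m \<noteq> 0"
    using M(1,2) assms(1) by (metis UNIV_I singletonD)
  then obtain k where k: "m = Suc k"
    using not0_implies_Suc by blast
  have flag: "is_flag B \<beta> k M"
    using M by (simp add: is_flag_def k)
  then have "\<theta> \<in> coamoeba B (flag_complement_image B \<beta> k M)"
    unfolding mem_flag_coamoeba_iff[OF flag] using M(4) \<theta> k
    by (intro conjI exI[of _ u]) (auto simp: PiE_iff)
  with flag show ?thesis by blast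
qed

end

section \<open>The closure of the coamoeba\<close>

text \<open>
  A spanning set of forms separates points because a nonzero vector extends to a basis, so that some
  form is nonzero at it.
\<close>
lemma essential_arrangement_if_spanning:
  assumes "vector_space scl" "finite B" "\<beta> ` B \<subseteq> dual_space scl - {0}"
    and span: "module.span form_scale (\<beta> ` B) = dual_space scl"
  shows "essential_arrangement scl B \<beta>"
proof -
  interpret V: vector_space scl by fact
  interpret C: vector_space "(*) :: complex \<Rightarrow> complex \<Rightarrow> complex"
    by unfold_locales (simp_all add: algebra_simps)
  interpret VC: vector_space_pair scl "(*) :: complex \<Rightarrow> complex \<Rightarrow> complex" ..
  interpret D: vector_space form_scale by (rule vector_space_form_scale)
  show ?thesis
  proof (rule essential_arrangement.intro)
    show "v = 0" if v: "\<And>b. b \<in> B \<Longrightarrow> \<beta> b v = 0" for v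
    proof (rule ccontr)
      assume "v \<noteq> 0"
      then have "V.independent {v}" by simp
      then obtain f where f: "Vector_Spaces.linear scl (*) f" "f v = 1"
        using VC.linear_independent_extend[of "{v}" "\<lambda>_. 1"] by auto
      have "f \<in> D.span (\<beta> ` B)"
        using f(1) by (simp add: span dual_space_def)
      then have "f v = 0"
      proof (induction rule: D.span_induct)
        show "D.subspace {g. g v = 0}"
          by (simp add: D.subspace_def form_scale_def)
      qed (use v in auto)
      with f(2) show False by simp
    qed
  qed (use assms in \<open>auto simp: dual_space_def fun_eq_iff\<close>)
qed

theorem corollary2p4:
  fixes scl :: "complex \<Rightarrow> 'v::ab_group_add \<Rightarrow> 'v"
    and Basis :: "'v set"
    and B :: "'b set"
    and \<beta> :: "'b \<Rightarrow> 'v \<Rightarrow> complex"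
  assumes "finite_dimensional_vector_space scl Basis"
    and "\<exists>v::'v. v \<noteq> 0"
    and "finite B"
    and "\<beta> ` B \<subseteq> dual_space scl - {0}"
    and "module.span form_scale (\<beta> ` B) = dual_space scl"
  shows "torus B closure_of coamoeba B (complement_image UNIV B \<beta>) =
    (\<Union>(k, L) \<in> {(k, L). is_flag B \<beta> k L}. coamoeba B (flag_complement_image B \<beta> k L))"
proof -
  have "vector_space scl"
    using assms(1) by (rule finite_dimensional_vector_space.axioms(1))
  then interpret essential_arrangement scl B \<beta>
    using assms(3-5) by (rule essential_arrangement_if_spanning)
  show ?thesis
    using closure_subset_flag_coamoebas[OF assms(2)] flag_coamoeba_subset_closure by fast
qed

end
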